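(* A connected graph $G$ is thrifty if and only if $w(G)=1$.
   Context: A pebbling distribution assigns to each vertex $v$ a non-negative integer $D(v)$ of pebbles; a rooted distribution fixes a root $r$. A pebbling step $[a,b]$, for adjacent $a,b$, removes two pebbles from $a$ and adds one to $b$; it is greedy if $d(a,r)>d(b,r)$ ($d$ = graph distance). A rooted distribution is $r$-solvable if some sequence of pebbling steps (a solution) ends with at least one pebble on $r$; it is $r$-critical if it is $r$-solvable but removing any single pebble makes it not $r$-solvable; it is greedy if it has a solution using only greedy steps. $c_r(G)$ is the largest size of an $r$-critical rooted distribution on $G$ over all roots $r$; an $r$-ceiling distribution is an $r$-critical rooted distribution (any root) with exactly $c_r(G)$ pebbles. $G$ is thrifty if every $r$-ceiling distribution on $G$ is greedy. The weight of a rooted distribution is $w(D)=\sum_v D(v)/2^{d(v,r)}$, and $w(G)$ is the largest weight of an $r$-ceiling distribution on $G$. *)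

theory Defs
  imports Complex_Main "Graph_Theory.Digraph_Component"
begin

text \<open>
  A finite simple undirected graph is represented as a finite symmetric digraph without loops
  or parallel arcs (locale \<^locale>\<open>graph\<close>); an undirected edge corresponds to a pair of opposite arcs.
\<close>

definition graph_dist :: "('a, 'b) pre_digraph \<Rightarrow> 'a \<Rightarrow> 'a \<Rightarrow> nat" where
  "graph_dist G u v = (LEAST n. \<exists>p. pre_digraph.awalk G u p v \<and> length p = n)"

text \<open>
  Distributions are functions on the whole vertex type that vanish outside the vertex set,
  so that they correspond one-to-one to functions on the vertex set.
\<close>

definition rooted_distribution :: "('a, 'b) pre_digraph \<Rightarrow> 'a \<Rightarrow> ('a \<Rightarrow> nat) \<Rightarrow> bool" where
  "rooted_distribution G r D \<longleftrightarrow> r \<in> verts G \<and> (\<forall>v. v \<notin> verts G \<longrightarrow> D v = 0)"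

definition distribution_size :: "('a, 'b) pre_digraph \<Rightarrow> ('a \<Rightarrow> nat) \<Rightarrow> nat" where
  "distribution_size G D = (\<Sum>v\<in>verts G. D v)"

fun pebbling_step :: "('a, 'b) pre_digraph \<Rightarrow> 'a \<times> 'a \<Rightarrow> ('a \<Rightarrow> nat) \<Rightarrow> ('a \<Rightarrow> nat) \<Rightarrow> bool" where
  "pebbling_step G (a, b) D D' \<longleftrightarrow>
     a \<rightarrow>\<^bsub>G\<^esub> b \<and> 2 \<le> D a \<and> D' = D(a := D a - 2, b := D b + 1)"

fun greedy_step :: "('a, 'b) pre_digraph \<Rightarrow> 'a \<Rightarrow> 'a \<times> 'a \<Rightarrow> bool" where
  "greedy_step G r (a, b) \<longleftrightarrow> graph_dist G a r > graph_dist G b r"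

fun pebbling_sequence ::
    "('a, 'b) pre_digraph \<Rightarrow> ('a \<times> 'a) list \<Rightarrow> ('a \<Rightarrow> nat) \<Rightarrow> ('a \<Rightarrow> nat) \<Rightarrow> bool" where
  "pebbling_sequence G [] D D' \<longleftrightarrow> D' = D"
| "pebbling_sequence G (s # ss) D D' \<longleftrightarrow>
     (\<exists>E. pebbling_step G s D E \<and> pebbling_sequence G ss E D')"

definition solution :: "('a, 'b) pre_digraph \<Rightarrow> 'a \<Rightarrow> ('a \<Rightarrow> nat) \<Rightarrow> ('a \<times> 'a) list \<Rightarrow> bool" where
  "solution G r D ss \<longleftrightarrow> (\<exists>D'. pebbling_sequence G ss D D' \<and> 1 \<le> D' r)"

definition r_solvable :: "('a, 'b) pre_digraph \<Rightarrow> 'a \<Rightarrow> ('a \<Rightarrow> nat) \<Rightarrow> bool" where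
  "r_solvable G r D \<longleftrightarrow> (\<exists>ss. solution G r D ss)"

definition greedy :: "('a, 'b) pre_digraph \<Rightarrow> 'a \<Rightarrow> ('a \<Rightarrow> nat) \<Rightarrow> bool" where
  "greedy G r D \<longleftrightarrow> (\<exists>ss. solution G r D ss \<and> (\<forall>s\<in>set ss. greedy_step G r s))"

definition r_critical :: "('a, 'b) pre_digraph \<Rightarrow> 'a \<Rightarrow> ('a \<Rightarrow> nat) \<Rightarrow> bool" where
  "r_critical G r D \<longleftrightarrow>
     rooted_distribution G r D \<and> r_solvable G r D \<and>
     (\<forall>v\<in>verts G. 1 \<le> D v \<longrightarrow> \<not> r_solvable G r (D(v := D v - 1)))"

text \<open>
  For a nonempty finite connected graph the sets whose maxima are taken below are finite and
  nonempty: a distribution consisting of one pebble on the root is critical, and for each root the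
  size of a critical distribution is bounded because a vertex \<open>v\<close> carries at most
  \<open>2 ^ graph_dist G v r\<close> pebbles.
\<close>

definition c_r :: "('a, 'b) pre_digraph \<Rightarrow> nat" where
  "c_r G = Max {distribution_size G D | r D. r_critical G r D}"

definition r_ceiling :: "('a, 'b) pre_digraph \<Rightarrow> 'a \<Rightarrow> ('a \<Rightarrow> nat) \<Rightarrow> bool" where
  "r_ceiling G r D \<longleftrightarrow> r_critical G r D \<and> distribution_size G D = c_r G"

definition thrifty :: "('a, 'b) pre_digraph \<Rightarrow> bool" where
  "thrifty G \<longleftrightarrow> (\<forall>r D. r_ceiling G r D \<longrightarrow> greedy G r D)"

definition distribution_weight :: "('a, 'b) pre_digraph \<Rightarrow> 'a \<Rightarrow> ('a \<Rightarrow> nat) \<Rightarrow> real" where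
  "distribution_weight G r D = (\<Sum>v\<in>verts G. real (D v) / 2 ^ graph_dist G v r)"

definition graph_weight :: "('a, 'b) pre_digraph \<Rightarrow> real" where
  "graph_weight G = Max {distribution_weight G r D | r D. r_ceiling G r D}"

end

theory Submission
  imports Defs
begin

text \<open>
  A pebbling step never increases the weight, and it preserves the weight exactly when it is greedy.
  A solution of a critical distribution leaves a single pebble, on the root, since any other
  remaining pebble could be traced back to a superfluous initial one. Hence a critical distribution
  has weight at least 1, with equality iff it is greedy. As there are only finitely many
  ceiling distributions, the largest weight is 1 iff all of them are greedy.
\<close>

section \<open>Monotonicity of solvability\<close>

text \<open>The same steps can be replayed on the larger distribution; the extra pebbles just stay
  where they are.\<close>

lemma pebbling_sequence_mono:
  assumes "pebbling_sequence G ss D D'" "D \<le> E"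
  shows "\<exists>E'. pebbling_sequence G ss E E' \<and> D' \<le> E'"
  using assms
proof (induction ss arbitrary: D E)
  case (Cons s ss)
  obtain a b where s: "s = (a, b)" by (cases s)
  obtain D1 where D1: "pebbling_step G (a, b) D D1" "pebbling_sequence G ss D1 D'"
    using Cons.prems(1) s by auto
  define E1 where "E1 = E(a := E a - 2, b := E b + 1)"
  have "pebbling_step G (a, b) E E1"
    using D1(1) le_funD[OF Cons.prems(2), of a] unfolding E1_def by auto
  moreover have "D1 \<le> E1"
    using D1(1) Cons.prems(2) unfolding E1_def by (auto simp: le_fun_def diff_le_mono)
  ultimately show ?case using Cons.IH[OF D1(2)] s by auto
qed auto

lemma r_solvable_mono:
  assumes "r_solvable G r D" "D \<le> E"
  shows "r_solvable G r E"
proof -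
  obtain ss D' where D': "pebbling_sequence G ss D D'" "1 \<le> D' r"
    using assms(1) unfolding r_solvable_def solution_def by auto
  obtain E' where "pebbling_sequence G ss E E'" "D' \<le> E'"
    using pebbling_sequence_mono[OF D'(1) assms(2)] by auto
  then show ?thesis
    using D'(2) le_funD[of D' E' r] unfolding r_solvable_def solution_def by (meson le_trans)
qed

lemma r_solvable_backward:
  assumes "pebbling_sequence G ss D E" "r_solvable G r E"
  shows "r_solvable G r D"
  using assms
proof (induction ss arbitrary: D)
  case (Cons s ss)
  then obtain D1 where "pebbling_step G s D D1" "r_solvable G r D1" by auto
  then show ?case
    unfolding r_solvable_def solution_def by (meson pebbling_sequence.simps(2))
qed auto

context graph
begin

lemma adj_neq: "a \<rightarrow>\<^bsub>G\<^esub> b \<Longrightarrow> a \<noteq> b"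
  using adj_not_same by blast

text \<open>The third assumption says that \<open>D'\<close> has a pebble besides the one needed on
  \<open>r\<close>: a second one if \<open>v = r\<close>, any one otherwise. Going backwards through
  the steps, such a spare pebble is followed to one that \<open>D\<close> can spare.\<close>

lemma superfluous_pebble:
  assumes "pebbling_sequence G ss D D'" "1 \<le> D' r" "D' v + (if v = r then 0 else 1) \<ge> 2"
    and "v \<in> verts G"
  shows "\<exists>u\<in>verts G. 1 \<le> D u \<and> r_solvable G r (D(u := D u - 1))"
  using assms
proof (induction ss arbitrary: D)
  case Nil
  have "solution G r (D(v := D v - 1)) []"
    using Nil unfolding solution_def by (auto split: if_splits)
  then show ?case
    using Nil unfolding r_solvable_def by (intro bexI[of _ v]) (auto split: if_splits)
next
  case (Cons s ss)
  obtain a b where s: "s = (a, b)" by (cases s)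
  obtain E where E: "pebbling_step G (a, b) D E" "pebbling_sequence G ss E D'"
    using Cons.prems(1) s by auto
  from E(1) have ab: "a \<rightarrow>\<^bsub>G\<^esub> b" "2 \<le> D a" "E = D(a := D a - 2, b := D b + 1)" by auto
  from ab(1) have neq: "a \<noteq> b" and a: "a \<in> verts G" using adj_neq adj_in_verts by auto
  obtain u where u: "u \<in> verts G" "1 \<le> E u" "r_solvable G r (E(u := E u - 1))"
    using Cons.IH[OF E(2) Cons.prems(2-4)] by blast
  show ?case
  proof (cases "u = b")
    case True
    \<comment> \<open>If the spare pebble lies on \<open>b\<close>, the step can be skipped:
      \<open>E\<close> without it is \<open>D\<close> with two pebbles fewer on \<open>a\<close>, so
      one of these two was spare.\<close>
    have "E(u := E u - 1) \<le> D(a := D a - 1)"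
      using neq ab True by (auto simp: le_fun_def)
    then have "r_solvable G r (D(a := D a - 1))" using r_solvable_mono[OF u(3)] by blast
    moreover have "1 \<le> D a" using ab(2) by simp
    ultimately show ?thesis using a by blast
  next
    case False
    \<comment> \<open>Off \<open>b\<close> the spare pebble was there before the step, which still
      works without it: if \<open>u = a\<close>, then \<open>1 \<le> E a\<close> means that
      \<open>D a\<close> is at least 3.\<close>
    have "pebbling_step G (a, b) (D(u := D u - 1)) (E(u := E u - 1))"
      using ab u(2) False neq by (auto simp: fun_eq_iff)
    then have "pebbling_sequence G [(a, b)] (D(u := D u - 1)) (E(u := E u - 1))" by simp
    then have "r_solvable G r (D(u := D u - 1))" using u(3) by (rule r_solvable_backward)
    moreover have "1 \<le> D u" using u(2) ab False by (auto split: if_splits)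
    ultimately show ?thesis using u(1) by blast
  qed
qed

section \<open>Transport of pebbles along walks\<close>

lemma move_pebbles:
  assumes "a \<rightarrow>\<^bsub>G\<^esub> b" "2 * k \<le> D a"
  shows "\<exists>ss D'. pebbling_sequence G ss D D' \<and> D b + k \<le> D' b"
  using assms(2)
proof (induction k arbitrary: D)
  case 0
  then show ?case by (metis add.right_neutral le_refl pebbling_sequence.simps(1))
next
  case (Suc k)
  let ?E = "D(a := D a - 2, b := D b + 1)"
  have "pebbling_step G (a, b) D ?E" using assms(1) Suc.prems by auto
  moreover have "2 * k \<le> ?E a" using assms(1) adj_neq Suc.prems by auto
  then obtain ss D' where "pebbling_sequence G ss ?E D'" "?E b + k \<le> D' b"
    using Suc.IH by blast
  ultimately show ?case
    by (intro exI[of _ "(a, b) # ss"] exI[of _ D']) auto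
qed

text \<open>Crossing an arc halves the pile, so \<open>2 ^ length p\<close> pebbles shrink to one
  exactly at the end of the walk.\<close>

lemma r_solvable_awalk:
  assumes "awalk u p r" "2 ^ length p \<le> D u"
  shows "r_solvable G r D"
  using assms
proof (induction p arbitrary: u D)
  case Nil
  then have "solution G r D []" unfolding solution_def by (auto simp: awalk_Nil_iff)
  then show ?case unfolding r_solvable_def by blast
next
  case (Cons e p)
  then have e: "e \<in> arcs G" "u = tail G e" "awalk (head G e) p r"
    by (auto simp: awalk_Cons_iff)
  then have "u \<rightarrow>\<^bsub>G\<^esub> head G e" by (auto intro: in_arcs_imp_in_arcs_ends)
  then obtain ss D' where D': "pebbling_sequence G ss D D'" "2 ^ length p \<le> D' (head G e)"
    using move_pebbles[of u "head G e" "2 ^ length p" D] Cons.prems(2)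
    by (auto dest: add_leD2)
  then show ?case using r_solvable_backward[OF D'(1)] Cons.IH[of "head G e" D'] e(3) by simp
qed

section \<open>Weight of a distribution under pebbling steps\<close>

lemma distribution_weight_step:
  assumes "pebbling_step G (a, b) D E"
  shows "distribution_weight G r E =
    distribution_weight G r D - 2 / 2 ^ graph_dist G a r + 1 / 2 ^ graph_dist G b r"
proof -
  let ?f = "\<lambda>v. 1 / (2 :: real) ^ graph_dist G v r"
  from assms have ab: "a \<rightarrow>\<^bsub>G\<^esub> b" "2 \<le> D a" "E = D(a := D a - 2, b := D b + 1)" by auto
  have neq: "a \<noteq> b" and ver: "a \<in> verts G" "b \<in> verts G"
    using ab(1) adj_neq adj_in_verts by auto
  \<comment> \<open>Written with indicator terms at \<open>a\<close> and \<open>b\<close>, so that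
    they collapse when summed over all vertices.\<close>
  have "real (E v) * ?f v =
      real (D v) * ?f v - (if v = a then 2 * ?f a else 0) + (if v = b then ?f b else 0)" for v
    using ab neq by (auto simp: diff_divide_distrib add_divide_distrib)
  then have "(\<Sum>v\<in>verts G. real (E v) * ?f v) =
      (\<Sum>v\<in>verts G. real (D v) * ?f v) - 2 * ?f a + ?f b"
    using ver by (simp add: sum.distrib sum_subtractf)
  then show ?thesis unfolding distribution_weight_def by simp
qed

lemma distribution_weight_ge_1:
  assumes "1 \<le> D r" "r \<in> verts G"
  shows "1 \<le> distribution_weight G r D"
proof -
  have "graph_dist G r r = 0"
    unfolding graph_dist_def using assms(2) by (auto simp: awalk_Nil_iff)
  then have "1 \<le> real (D r) / 2 ^ graph_dist G r r" using assms(1) by simp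
  also have "\<dots> \<le> distribution_weight G r D"
    unfolding distribution_weight_def using assms(2) by (intro member_le_sum) auto
  finally show ?thesis .
qed

end

locale connected_graph = graph +
  assumes connected: "connected G"
begin

lemma ex_shortest_awalk:
  assumes "u \<in> verts G" "v \<in> verts G"
  shows "\<exists>p. awalk u p v \<and> length p = graph_dist G u v"
proof -
  \<comment> \<open>Since arcs come in opposite pairs, connectedness gives directed walks.\<close>
  have "u \<rightarrow>\<^sup>* v"
    using connected assms symmetric_connected_imp_strongly_connected[OF sym_arcs]
    by auto
  then have "\<exists>n p. awalk u p v \<and> length p = n" by (auto simp: reachable_awalk)
  then show ?thesis unfolding graph_dist_def by (rule LeastI_ex)
qed

text \<open>Prepending the arc to a shortest walk from \<open>b\<close> gives a walk from
  \<open>a\<close>. Hence a greedy step shortens the distance by exactly one, which is why it keeps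
  the weight.\<close>

lemma graph_dist_adj_le:
  assumes "a \<rightarrow>\<^bsub>G\<^esub> b" "r \<in> verts G"
  shows "graph_dist G a r \<le> graph_dist G b r + 1"
proof -
  obtain e where e: "e \<in> arcs G" "tail G e = a" "head G e = b" using assms(1) by auto
  obtain p where p: "awalk b p r" "length p = graph_dist G b r"
    using ex_shortest_awalk assms adj_in_verts by blast
  have "awalk a (e # p) r" using e p(1) by (auto simp: awalk_Cons_iff)
  then show ?thesis
    unfolding graph_dist_def[of G a] using p(2) by (intro Least_le) auto
qed

lemma distribution_weight_greedy_step:
  assumes "pebbling_step G s D E" "r \<in> verts G" "greedy_step G r s"
  shows "distribution_weight G r E = distribution_weight G r D"
proof -
  obtain a b where s: "s = (a, b)" by (cases s)
  then have "a \<rightarrow>\<^bsub>G\<^esub> b" using assms(1) by auto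
  then have "graph_dist G a r = graph_dist G b r + 1"
    using graph_dist_adj_le[of a b r] assms(2,3) s by auto
  then show ?thesis using distribution_weight_step[of a b D E r] assms(1) s by simp
qed

text \<open>The new pebble is no closer to \<open>r\<close> than the two removed ones, so it regains
  at most half of the weight lost.\<close>

lemma distribution_weight_nongreedy_step:
  assumes "pebbling_step G s D E" "\<not> greedy_step G r s"
  shows "distribution_weight G r E < distribution_weight G r D"
proof -
  obtain a b where s: "s = (a, b)" by (cases s)
  have "(2 :: real) ^ graph_dist G a r \<le> 2 ^ graph_dist G b r"
    using assms(2) s by (intro power_increasing) auto
  then have "1 / (2 :: real) ^ graph_dist G b r \<le> 1 / 2 ^ graph_dist G a r"
    by (intro divide_left_mono) auto
  also have "\<dots> < 2 / 2 ^ graph_dist G a r" by (simp add: divide_strict_right_mono)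
  finally show ?thesis using distribution_weight_step[of a b D E r] assms(1) s by simp
qed

text \<open>No step raises the weight, so a loss at one non-greedy step is never made up
  later.\<close>

lemma distribution_weight_sequence:
  assumes "pebbling_sequence G ss D D'" "r \<in> verts G"
  shows "distribution_weight G r D' \<le> distribution_weight G r D \<and>
    (distribution_weight G r D' = distribution_weight G r D \<longleftrightarrow> (\<forall>s\<in>set ss. greedy_step G r s))"
  using assms(1)
proof (induction ss arbitrary: D)
  case (Cons s ss)
  then obtain E where E: "pebbling_step G s D E" "pebbling_sequence G ss E D'" by auto
  show ?case
    using Cons.IH[OF E(2)] distribution_weight_greedy_step[OF E(1) assms(2)]
      distribution_weight_nongreedy_step[OF E(1), of r]
    by (cases "greedy_step G r s") auto
qed auto

lemma r_solvable_weight_ge_1: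
  assumes "r_solvable G r D" "r \<in> verts G"
  shows "1 \<le> distribution_weight G r D"
proof -
  obtain ss D' where "pebbling_sequence G ss D D'" "1 \<le> D' r"
    using assms(1) unfolding r_solvable_def solution_def by auto
  then show ?thesis
    using distribution_weight_ge_1[of D' r] distribution_weight_sequence[of ss D D' r] assms(2)
    by linarith
qed

section \<open>Weight and size of critical distributions\<close>

lemma r_critical_final_weight:
  assumes "r_critical G r D" "pebbling_sequence G ss D D'" "1 \<le> D' r"
  shows "distribution_weight G r D' = 1"
proof -
  have r: "r \<in> verts G" using assms(1) unfolding r_critical_def rooted_distribution_def by auto
  \<comment> \<open>A spare pebble at the end would contradict criticality, so \<open>D'\<close> has
    at most one pebble on \<open>r\<close> and none elsewhere.\<close>
  have small: "D' v + (if v = r then 0 else 1) < 2" if "v \<in> verts G" for v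
    using superfluous_pebble[OF assms(2,3) _ that] assms(1) unfolding r_critical_def
    by (meson not_le)
  have "D' v = (if v = r then 1 else 0)" if "v \<in> verts G" for v
    using small[OF that] assms(3) by (auto split: if_splits)
  then have "distribution_weight G r D' =
      (\<Sum>v\<in>verts G. if v = r then 1 / 2 ^ graph_dist G r r else 0)"
    unfolding distribution_weight_def by (intro sum.cong) auto
  also have "\<dots> = 1 / 2 ^ graph_dist G r r" using r by simp
  finally have "distribution_weight G r D' \<le> 1" by simp
  then show ?thesis using distribution_weight_ge_1[of D' r] assms(3) r by linarith
qed

lemma r_critical_greedy_iff:
  assumes "r_critical G r D"
  shows "greedy G r D \<longleftrightarrow> distribution_weight G r D = 1"
proof -
  have r: "r \<in> verts G" using assms unfolding r_critical_def rooted_distribution_def by auto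
  have "(\<forall>s\<in>set ss. greedy_step G r s) \<longleftrightarrow> distribution_weight G r D = 1"
    if "solution G r D ss" for ss
    using that r_critical_final_weight[OF assms] distribution_weight_sequence[OF _ r]
    unfolding solution_def by metis
  then show ?thesis
    using assms unfolding greedy_def r_critical_def r_solvable_def by blast
qed

text \<open>With more pebbles on \<open>v\<close>, one could be removed and the rest would still
  suffice to reach \<open>r\<close> along a shortest walk.\<close>

lemma r_critical_le:
  assumes "r_critical G r D" "v \<in> verts G"
  shows "D v \<le> 2 ^ graph_dist G v r"
proof (rule ccontr)
  assume *: "\<not> D v \<le> 2 ^ graph_dist G v r"
  have r: "r \<in> verts G" using assms unfolding r_critical_def rooted_distribution_def by auto
  obtain p where "awalk v p r" "length p = graph_dist G v r"
    using ex_shortest_awalk[OF assms(2) r] by auto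
  then have "r_solvable G r (D(v := D v - 1))" using * by (intro r_solvable_awalk) auto
  then show False using * assms unfolding r_critical_def by auto
qed

section \<open>Ceiling distributions and their maximal weight\<close>

lemma finite_r_critical: "finite {(r, D). r_critical G r D}"
proof -
  \<comment> \<open>A bound for all roots and vertices at once: each
    \<open>2 ^ graph_dist G v r\<close> is one of the summands.\<close>
  define N where "N = (\<Sum>r\<in>verts G. \<Sum>v\<in>verts G. 2 ^ graph_dist G v r :: nat)"
  let ?F = "{D. \<forall>v. (v \<in> verts G \<longrightarrow> D v \<in> {..N}) \<and> (v \<notin> verts G \<longrightarrow> D v = 0)}"
  have "D v \<le> N" if D: "r_critical G r D" and v: "v \<in> verts G" for r D v
  proof -
    have r: "r \<in> verts G" using D unfolding r_critical_def rooted_distribution_def by auto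
    have "D v \<le> 2 ^ graph_dist G v r" by (rule r_critical_le[OF D v])
    also have "\<dots> \<le> (\<Sum>v\<in>verts G. 2 ^ graph_dist G v r)"
      using v by (intro member_le_sum) auto
    also have "\<dots> \<le> N" unfolding N_def
      using r member_le_sum[of r "verts G" "\<lambda>r. \<Sum>v\<in>verts G. 2 ^ graph_dist G v r :: nat"] by simp
    finally show ?thesis .
  qed
  then have "{(r, D). r_critical G r D} \<subseteq> verts G \<times> ?F"
    by (auto simp: r_critical_def rooted_distribution_def)
  moreover have "finite (verts G \<times> ?F)"
    by (intro finite_cartesian_product finite_set_of_finite_funs) auto
  ultimately show ?thesis by (rule finite_subset)
qed

lemma ex_r_critical: "\<exists>r D. r_critical G r D"
proof -
  obtain r where r: "r \<in> verts G" using connected by (auto simp: connected_def strongly_connected_def)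
  define D :: "'a \<Rightarrow> nat" where "D = (\<lambda>v. 0)(r := 1)"
  have "solution G r D []" unfolding solution_def D_def by auto
  \<comment> \<open>The empty distribution has weight 0, below the 1 that solvability
    demands.\<close>
  moreover have "\<not> r_solvable G r (\<lambda>v. 0)"
    using r_solvable_weight_ge_1[OF _ r, of "\<lambda>v. 0"] by (auto simp: distribution_weight_def)
  ultimately have "r_critical G r D"
    using r unfolding r_critical_def rooted_distribution_def r_solvable_def[of G r D]
    by (auto simp: D_def fun_upd_def cong: if_cong)
  then show ?thesis by blast
qed

lemma ex_r_ceiling: "\<exists>r D. r_ceiling G r D"
proof -
  let ?S = "{distribution_size G D | r D. r_critical G r D}"
  have "?S = (\<lambda>(r, D). distribution_size G D) ` {(r, D). r_critical G r D}" by auto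
  then have "finite ?S" using finite_r_critical by simp
  moreover have "?S \<noteq> {}" using ex_r_critical by auto
  ultimately have "c_r G \<in> ?S" unfolding c_r_def by (rule Max_in)
  then show ?thesis unfolding r_ceiling_def by force
qed

lemma thrifty_iff: "thrifty G \<longleftrightarrow> graph_weight G = 1"
proof -
  let ?W = "{distribution_weight G r D | r D. r_ceiling G r D}"
  have "?W = (\<lambda>(r, D). distribution_weight G r D) ` {(r, D). r_ceiling G r D}" by auto
  moreover have "finite {(r, D). r_ceiling G r D}"
    by (rule finite_subset[OF _ finite_r_critical]) (auto simp: r_ceiling_def)
  ultimately have fin: "finite ?W" by simp
  have ne: "?W \<noteq> {}" using ex_r_ceiling by auto
  have ge: "1 \<le> w" if "w \<in> ?W" for w
    using that r_solvable_weight_ge_1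
    by (auto simp: r_ceiling_def r_critical_def rooted_distribution_def)
  \<comment> \<open>Ceiling distributions are critical, so being greedy can be read off their
    weight.\<close>
  have "thrifty G \<longleftrightarrow> (\<forall>w\<in>?W. w = 1)"
    using r_critical_greedy_iff unfolding thrifty_def r_ceiling_def by blast
  also have "\<dots> \<longleftrightarrow> Max ?W = 1"
  proof
    assume "\<forall>w\<in>?W. w = 1"
    then show "Max ?W = 1" using Max_in[OF fin ne] by blast
  next
    assume "Max ?W = 1"
    then have "w \<le> 1" if "w \<in> ?W" for w using Max_ge[OF fin that] by simp
    then show "\<forall>w\<in>?W. w = 1" using ge by (blast intro: order_antisym)
  qed
  finally show ?thesis unfolding graph_weight_def .
qed

end

theorem theorem14:
  fixes G :: "('a, 'b) pre_digraph"
  assumes "graph G"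
    and "Digraph_Component.connected G"
  shows "thrifty G \<longleftrightarrow> graph_weight G = 1"
proof -
  interpret connected_graph G
    using assms by (intro connected_graph.intro connected_graph_axioms.intro)
  show ?thesis by (rule thrifty_iff)
qed

end
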